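(* Let $\alpha,\beta\in\mathbb{R}$ satisfy $-1<\alpha<1$, $-1<\beta<1$ and $\alpha+\beta>0$, and let $1<p<q<\infty$. Let $\mathbf{I}_{\alpha\beta}$ be the fractional integral operator on $\mathbb{R}^3$ given by $$\mathbf{I}_{\alpha\beta}f(x)=\int_{\mathbb{R}^3} f(y)\,\mathbf{V}^{\alpha\beta}(x-y)\,dy,$$ $$\mathbf{V}^{\alpha\beta}(x)=|x_1|^{\alpha-1}|x_2|^{\alpha-1}|x_3|^{\beta-1}\left[\frac{|x_1||x_2|}{|x_3|}+\frac{|x_3|}{|x_1||x_2|}\right]^{-1},\qquad x_i\neq 0,\ i=1,2,3.$$ Then there exists a constant $C=C(\alpha,\beta,p,q)>0$ such that $$\|\mathbf{I}_{\alpha\beta}f\|_{L^q(\mathbb{R}^3)}\le C\,\|f\|_{L^p(\mathbb{R}^3)}\qquad\text{for all } f\in L^p(\mathbb{R}^3)$$ if and only if $$\frac{\alpha+\beta}{2}=\frac1p-\frac1q.$$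
   Context: $L^p(\mathbb{R}^3)$ is taken with respect to Lebesgue measure. The kernel $\mathbf{V}^{\alpha\beta}$ is nonnegative and is defined off the null set where some coordinate vanishes. *)

theory Defs
  imports "HOL-Analysis.Analysis"
begin

text \<open>Exponents are meant to be finite and at least 1. As usual, functions are used in place of
  their almost-everywhere equivalence classes.\<close>

definition Lp_space :: "real \<Rightarrow> (real^3 \<Rightarrow> complex) set" where
  "Lp_space p = {f \<in> borel_measurable lebesgue. integrable lebesgue (\<lambda>x. norm (f x) powr p)}"

definition Lp_norm :: "real \<Rightarrow> (real^3 \<Rightarrow> complex) \<Rightarrow> real" where
  "Lp_norm p f = (LINT x|lebesgue. norm (f x) powr p) powr (1 / p)"

text \<open>Where a coordinate vanishes, the kernel has the junk value 0 (from \<open>0 powr a = 0\<close>); this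
  happens on a null set only.\<close>

definition V :: "real \<Rightarrow> real \<Rightarrow> real^3 \<Rightarrow> real" where
  "V \<alpha> \<beta> x = \<bar>x$1\<bar> powr (\<alpha> - 1) * \<bar>x$2\<bar> powr (\<alpha> - 1) * \<bar>x$3\<bar> powr (\<beta> - 1) *
     inverse (\<bar>x$1\<bar> * \<bar>x$2\<bar> / \<bar>x$3\<bar> + \<bar>x$3\<bar> / (\<bar>x$1\<bar> * \<bar>x$2\<bar>))"

definition frac_integrand :: "real \<Rightarrow> real \<Rightarrow> (real^3 \<Rightarrow> complex) \<Rightarrow> real^3 \<Rightarrow> real^3 \<Rightarrow> complex" where
  "frac_integrand \<alpha> \<beta> f x y = f y * complex_of_real (V \<alpha> \<beta> (x - y))"

definition frac_int :: "real \<Rightarrow> real \<Rightarrow> (real^3 \<Rightarrow> complex) \<Rightarrow> real^3 \<Rightarrow> complex" where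
  "frac_int \<alpha> \<beta> f x = (LINT y|lebesgue. frac_integrand \<alpha> \<beta> f x y)"

text \<open>The norm inequality \<open>\<parallel>I f\<parallel>\<^sub>q \<le> C \<parallel>f\<parallel>\<^sub>p\<close> on all of \<open>L\<^sup>p\<close>. The Bochner integral is 0 for
  non-integrable functions, so the implicit parts of the inequality (the integral defining \<open>I f\<close>
  converges absolutely almost everywhere, and \<open>I f\<close> lies in \<open>L\<^sup>q\<close>) have to be stated explicitly;
  otherwise divergence would make the inequality vacuously true.\<close>

definition frac_int_bound :: "real \<Rightarrow> real \<Rightarrow> real \<Rightarrow> real \<Rightarrow> real \<Rightarrow> bool" where
  "frac_int_bound \<alpha> \<beta> p q C \<longleftrightarrow>
     (\<forall>f \<in> Lp_space p.
        (AE x in lebesgue. integrable lebesgue (frac_integrand \<alpha> \<beta> f x)) \<and>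
        frac_int \<alpha> \<beta> f \<in> Lp_space q \<and>
        Lp_norm q (frac_int \<alpha> \<beta> f) \<le> C * Lp_norm p f)"

end

theory Submission
  imports Defs
begin

text \<open>Necessity: test the inequality on boxes with sides \<open>t, 1, t\<close>, to which the kernel scales. Sufficiency:
  with \<open>s = (\<alpha> + \<beta>) / 2\<close> the kernel is at most \<open>\<bar>x\<^sub>1\<bar>\<^bsup>s-1\<^esup> \<bar>x\<^sub>2\<bar>\<^bsup>s-1\<^esup> \<bar>x\<^sub>3\<bar>\<^bsup>s-1\<^esup>\<close>, so one needs the
  Hardy--Littlewood--Sobolev inequality in each variable. Dualized, it is a bound for a bilinear form, and
  such bounds pass to tensor products by Tonelli's theorem alone. Writing \<open>f = F\<^bsup>1/p\<^esup>\<close> and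
  \<open>h = G\<^bsup>1-1/q\<^esup>\<close> with \<open>\<integral> F = \<integral> G = 1\<close>, the one-dimensional form is estimated directly, without maximal
  functions or interpolation.\<close>

subsection \<open>Powers of extended nonnegative reals\<close>

text \<open>With the densities \<open>F\<close> and \<open>G\<close> the exponents become plain
  powers \<open>a = 1/p\<close> and \<open>b = 1 - 1/q\<close>, and for \<open>l = 1 - s\<close> the
  homogeneity condition reads \<open>a + b + l = 2\<close>. Once both masses are 1,
  \<open>F x\<close> and \<open>G y\<close> have the same dimension on the line, an inverse length:
  they can be compared pointwise, and \<open>1 / F x\<close> is the natural distance at which to cut
  the kernel. The two pieces converge for separate reasons: near the diagonal because
  \<open>l < 1\<close>, that is \<alpha> + \<beta> > 0, and away from it because
  \<open>a < 1\<close>, that is p > 1 (with the roles exchanged \<open>b < 1\<close>, that is q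
  finite). All estimates are made for nonnegative integrals with values in \<open>ennreal\<close>,
  where Tonelli asks for no integrability; absolute convergence of the fractional integral is then a
  consequence of the bound and not a prerequisite. For necessity the dilation (t, 1, t) is used
  because it leaves the quotient of \<open>x1 x2\<close> by \<open>x3\<close> unchanged, so that the
  bracket does not spoil homogeneity. It multiplies volumes by t^2, which is the source of the 2 in
  (\<alpha> + \<beta>)/2.\<close>

definition ennpowr :: "ennreal \<Rightarrow> real \<Rightarrow> ennreal" where
  "ennpowr x a = (if x = top then top else ennreal (enn2real x powr a))"

lemma ennpowr_ennreal [simp]: "0 \<le> r \<Longrightarrow> ennpowr (ennreal r) a = ennreal (r powr a)"
  by (simp add: ennpowr_def)

lemma ennpowr_0 [simp]: "ennpowr 0 a = 0"
  by (simp add: ennpowr_def)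

lemma ennpowr_top [simp]: "ennpowr top a = top"
  by (simp add: ennpowr_def)

lemma ennpowr_eq_0_iff [simp]: "ennpowr x a = 0 \<longleftrightarrow> x = 0"
  by (cases x) (auto simp: ennpowr_def)

lemma ennpowr_eq_top_iff [simp]: "ennpowr x a = top \<longleftrightarrow> x = top"
  by (simp add: ennpowr_def)

text \<open>The conventions at 0 and \<open>top\<close> do not depend on the exponent, so the law
  holds for every real \<open>a\<close>, including the product of 0 and \<open>top\<close>.
  Rescaling of densities rests on it.\<close>

lemma ennpowr_mult: "ennpowr (x * y) a = ennpowr x a * ennpowr y a"
proof (cases "x = 0 \<or> y = 0 \<or> x = top \<or> y = top")
  case True
  then show ?thesis
    by (auto simp: ennreal_mult_top ennreal_top_mult)
next
  case False
  then obtain r s where "x = ennreal r" "y = ennreal s" "0 \<le> r" "0 \<le> s"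
    by (metis ennreal_cases)
  then show ?thesis
    by (simp add: powr_mult flip: ennreal_mult)
qed

lemma ennpowr_mono: "x \<le> y \<Longrightarrow> 0 \<le> a \<Longrightarrow> ennpowr x a \<le> ennpowr y a"
  by (auto simp: ennpowr_def top_unique less_top intro!: ennreal_leI powr_mono2 enn2real_mono)

lemma borel_measurable_ennpowr [measurable]:
  assumes [measurable]: "f \<in> borel_measurable M"
  shows "(\<lambda>x. ennpowr (f x) a) \<in> borel_measurable M"
  unfolding ennpowr_def by measurable

subsection \<open>Bilinear forms\<close>

text \<open>Boundedness of the form with kernel \<open>k\<close> on L^(1/a) x L^(1/b), tested on
  nonnegative functions written as powers of densities. In this form the right-hand side sees only
  total masses, and extended values are allowed so that partial integrals of a density are again
  admissible densities.\<close>

definition bilinear_bound ::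
    "real \<Rightarrow> real \<Rightarrow> 'a measure \<Rightarrow> 'b measure \<Rightarrow> ('a \<Rightarrow> 'b \<Rightarrow> ennreal) \<Rightarrow> ennreal \<Rightarrow> bool" where
  "bilinear_bound a b M N k A \<longleftrightarrow>
    (\<forall>F\<in>borel_measurable M. \<forall>G\<in>borel_measurable N.
      (\<integral>\<^sup>+x. \<integral>\<^sup>+y. ennpowr (F x) a * ennpowr (G y) b * k x y \<partial>N \<partial>M)
        \<le> A * ennpowr (\<integral>\<^sup>+x. F x \<partial>M) a * ennpowr (\<integral>\<^sup>+y. G y \<partial>N) b)"

lemma bilinear_boundD:
  assumes "bilinear_bound a b M N k A" "F \<in> borel_measurable M" "G \<in> borel_measurable N"
  shows "(\<integral>\<^sup>+x. \<integral>\<^sup>+y. ennpowr (F x) a * ennpowr (G y) b * k x y \<partial>N \<partial>M)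
        \<le> A * ennpowr (\<integral>\<^sup>+x. F x \<partial>M) a * ennpowr (\<integral>\<^sup>+y. G y \<partial>N) b"
  using assms unfolding bilinear_bound_def by blast

text \<open>Both sides are homogeneous of degree \<open>a\<close> in \<open>F\<close> and
  \<open>b\<close> in \<open>G\<close>, so dividing by the masses reduces to mass 1. A mass 0 makes
  the integrand vanish almost everywhere; an infinite mass against a nonzero one makes the
  right-hand side \<open>top\<close>, provided that \<open>A\<close> is not 0.\<close>

lemma bilinear_bound_normalized:
  fixes k :: "'a \<Rightarrow> 'b \<Rightarrow> ennreal"
  assumes [measurable]: "case_prod k \<in> borel_measurable (M \<Otimes>\<^sub>M N)"
    and sf: "sigma_finite_measure M" "sigma_finite_measure N" and A: "A \<noteq> 0"
    and unit: "\<And>F G. \<lbrakk>F \<in> borel_measurable M; G \<in> borel_measurable N;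
        (\<integral>\<^sup>+x. F x \<partial>M) = 1; (\<integral>\<^sup>+y. G y \<partial>N) = 1\<rbrakk> \<Longrightarrow>
        (\<integral>\<^sup>+x. \<integral>\<^sup>+y. ennpowr (F x) a * ennpowr (G y) b * k x y \<partial>N \<partial>M) \<le> A"
  shows "bilinear_bound a b M N k A"
  unfolding bilinear_bound_def
proof (intro ballI)
  interpret M: sigma_finite_measure M by fact
  interpret N: sigma_finite_measure N by fact
  fix F :: "'a \<Rightarrow> ennreal" and G :: "'b \<Rightarrow> ennreal"
  assume [measurable]: "F \<in> borel_measurable M" "G \<in> borel_measurable N"
  define I J where "I = (\<integral>\<^sup>+x. F x \<partial>M)" and "J = (\<integral>\<^sup>+y. G y \<partial>N)"
  have k[measurable]: "(\<lambda>y. k x y) \<in> borel_measurable N" if "x \<in> space M" for x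
    using that by measurable
  consider "I = 0" | "J = 0" | "I \<noteq> 0" "J \<noteq> 0" "I = top \<or> J = top"
    | "I \<noteq> 0" "J \<noteq> 0" "I \<noteq> top" "J \<noteq> top" by blast
  then show "(\<integral>\<^sup>+x. \<integral>\<^sup>+y. ennpowr (F x) a * ennpowr (G y) b * k x y \<partial>N \<partial>M)
      \<le> A * ennpowr (\<integral>\<^sup>+x. F x \<partial>M) a * ennpowr (\<integral>\<^sup>+y. G y \<partial>N) b" (is "?L \<le> _")
    unfolding I_def[symmetric] J_def[symmetric]
  proof cases
    case 1
    then have "AE x in M. F x = 0"
      by (simp add: I_def nn_integral_0_iff_AE)
    then have "?L = (\<integral>\<^sup>+x. 0 \<partial>M)"
      by (intro nn_integral_cong_AE) (auto elim!: eventually_mono)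
    then show "?L \<le> A * ennpowr I a * ennpowr J b"
      by simp
  next
    case 2
    then have "AE y in N. G y = 0"
      by (simp add: J_def nn_integral_0_iff_AE)
    then have "(\<integral>\<^sup>+y. ennpowr (F x) a * ennpowr (G y) b * k x y \<partial>N) = (\<integral>\<^sup>+y. 0 \<partial>N)" for x
      by (intro nn_integral_cong_AE) (elim eventually_mono, simp)
    then show "?L \<le> A * ennpowr I a * ennpowr J b"
      by simp
  next
    case 3
    then show "?L \<le> A * ennpowr I a * ennpowr J b"
      using A by (auto simp: ennreal_mult_top ennreal_top_mult)
  next
    case 4
    have inv: "inverse I * I = 1" "inverse J * J = 1"
      using 4 ennreal_divide_self[of I] ennreal_divide_self[of J]
      by (simp_all add: divide_ennreal_def mult.commute less_top)
    have "ennpowr (F x) a * ennpowr (G y) b * k x y = (ennpowr I a * ennpowr J b) *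
       (ennpowr (inverse I * F x) a * ennpowr (inverse J * G y) b * k x y)" for x y
    proof -
      have "F x = I * (inverse I * F x)" "G y = J * (inverse J * G y)"
        using inv by (simp_all add: mult.assoc[symmetric] mult.commute)
      then have "ennpowr (F x) a = ennpowr I a * ennpowr (inverse I * F x) a"
          "ennpowr (G y) b = ennpowr J b * ennpowr (inverse J * G y) b"
        by (simp_all only: ennpowr_mult[symmetric])
      then show ?thesis by (simp add: mult_ac)
    qed
    then have "?L = (\<integral>\<^sup>+x. \<integral>\<^sup>+y. (ennpowr I a * ennpowr J b) *
       (ennpowr (inverse I * F x) a * ennpowr (inverse J * G y) b * k x y) \<partial>N \<partial>M)"
      by simp
    also have "\<dots> = (\<integral>\<^sup>+x. (ennpowr I a * ennpowr J b) *
       (\<integral>\<^sup>+y. ennpowr (inverse I * F x) a * ennpowr (inverse J * G y) b * k x y \<partial>N) \<partial>M)"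
      by (intro nn_integral_cong nn_integral_cmult) measurable
    also have "\<dots> = (ennpowr I a * ennpowr J b) *
       (\<integral>\<^sup>+x. \<integral>\<^sup>+y. ennpowr (inverse I * F x) a * ennpowr (inverse J * G y) b * k x y \<partial>N \<partial>M)"
      by (intro nn_integral_cmult) measurable
    also have "\<dots> \<le> (ennpowr I a * ennpowr J b) * A"
      using inv by (intro mult_left_mono unit) (auto simp: nn_integral_cmult simp flip: I_def J_def)
    finally show "?L \<le> A * ennpowr I a * ennpowr J b"
      by (simp add: mult_ac)
  qed
qed

text \<open>For frozen second coordinates the first bound, applied to slices of \<open>F\<close> and
  \<open>G\<close>, produces exactly the powers of their marginals. The second bound accepts these
  marginals as densities, and they have the same total masses as \<open>F\<close> and
  \<open>G\<close>.\<close>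

lemma bilinear_bound_tensor:
  fixes k1 :: "'a \<Rightarrow> 'b \<Rightarrow> ennreal" and k2 :: "'c \<Rightarrow> 'd \<Rightarrow> ennreal"
  assumes sf: "sigma_finite_measure M1" "sigma_finite_measure N1" "sigma_finite_measure M2" "sigma_finite_measure N2"
    and k [measurable]: "case_prod k1 \<in> borel_measurable (M1 \<Otimes>\<^sub>M N1)" "case_prod k2 \<in> borel_measurable (M2 \<Otimes>\<^sub>M N2)"
    and b1: "bilinear_bound a b M1 N1 k1 A1" and b2: "bilinear_bound a b M2 N2 k2 A2"
  shows "bilinear_bound a b (M1 \<Otimes>\<^sub>M M2) (N1 \<Otimes>\<^sub>M N2)
    (\<lambda>x y. k1 (fst x) (fst y) * k2 (snd x) (snd y)) (A1 * A2)"
  unfolding bilinear_bound_def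
proof (intro ballI)
  interpret M1: sigma_finite_measure M1 by fact
  interpret N1: sigma_finite_measure N1 by fact
  interpret M2: sigma_finite_measure M2 by fact
  interpret N2: sigma_finite_measure N2 by fact
  interpret M12: pair_sigma_finite M1 M2 ..
  interpret N12: pair_sigma_finite N1 N2 ..
  interpret M1N2: pair_sigma_finite M1 N2 ..
  fix F :: "'a \<times> 'c \<Rightarrow> ennreal" and G :: "'b \<times> 'd \<Rightarrow> ennreal"
  assume [measurable]: "F \<in> borel_measurable (M1 \<Otimes>\<^sub>M M2)" "G \<in> borel_measurable (N1 \<Otimes>\<^sub>M N2)"
  let ?F = "\<lambda>x2. \<integral>\<^sup>+x1. F (x1, x2) \<partial>M1" and ?G = "\<lambda>y2. \<integral>\<^sup>+y1. G (y1, y2) \<partial>N1"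
  let ?h = "\<lambda>x y. ennpowr (F x) a * ennpowr (G y) b * (k1 (fst x) (fst y) * k2 (snd x) (snd y))"
  have "(\<integral>\<^sup>+x. \<integral>\<^sup>+y. ?h x y \<partial>(N1 \<Otimes>\<^sub>M N2) \<partial>(M1 \<Otimes>\<^sub>M M2))
      = (\<integral>\<^sup>+x2. \<integral>\<^sup>+x1. \<integral>\<^sup>+y. ?h (x1, x2) y \<partial>(N1 \<Otimes>\<^sub>M N2) \<partial>M1 \<partial>M2)"
    by (rule M12.nn_integral_snd[symmetric]) measurable
  also have "\<dots> = (\<integral>\<^sup>+x2. \<integral>\<^sup>+x1. \<integral>\<^sup>+y2. \<integral>\<^sup>+y1. ?h (x1, x2) (y1, y2) \<partial>N1 \<partial>N2 \<partial>M1 \<partial>M2)"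
    by (intro nn_integral_cong N12.nn_integral_snd[symmetric]) measurable
  also have "\<dots> = (\<integral>\<^sup>+x2. \<integral>\<^sup>+y2. \<integral>\<^sup>+x1. \<integral>\<^sup>+y1. ?h (x1, x2) (y1, y2) \<partial>N1 \<partial>M1 \<partial>N2 \<partial>M2)"
    by (intro nn_integral_cong M1N2.Fubini'[symmetric]) measurable
  also have "\<dots> \<le> (\<integral>\<^sup>+x2. \<integral>\<^sup>+y2. A1 * (ennpowr (?F x2) a * ennpowr (?G y2) b * k2 x2 y2) \<partial>N2 \<partial>M2)"
  proof (intro nn_integral_mono)
    fix x2 y2 assume [measurable]: "x2 \<in> space M2" "y2 \<in> space N2"
    have "(\<integral>\<^sup>+x1. \<integral>\<^sup>+y1. ?h (x1, x2) (y1, y2) \<partial>N1 \<partial>M1)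
       = (\<integral>\<^sup>+x1. \<integral>\<^sup>+y1. k2 x2 y2 * (ennpowr (F (x1, x2)) a * ennpowr (G (y1, y2)) b * k1 x1 y1) \<partial>N1 \<partial>M1)"
      by (simp add: mult_ac)
    also have "\<dots> = (\<integral>\<^sup>+x1. k2 x2 y2 * (\<integral>\<^sup>+y1. ennpowr (F (x1, x2)) a * ennpowr (G (y1, y2)) b * k1 x1 y1 \<partial>N1) \<partial>M1)"
      by (intro nn_integral_cong nn_integral_cmult) measurable
    also have "\<dots> = k2 x2 y2 * (\<integral>\<^sup>+x1. \<integral>\<^sup>+y1. ennpowr (F (x1, x2)) a * ennpowr (G (y1, y2)) b * k1 x1 y1 \<partial>N1 \<partial>M1)"
      by (intro nn_integral_cmult) measurable
    also have "\<dots> \<le> k2 x2 y2 * (A1 * ennpowr (?F x2) a * ennpowr (?G y2) b)"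
      by (intro mult_left_mono bilinear_boundD[OF b1]) auto
    finally show "(\<integral>\<^sup>+x1. \<integral>\<^sup>+y1. ?h (x1, x2) (y1, y2) \<partial>N1 \<partial>M1) \<le> A1 * (ennpowr (?F x2) a * ennpowr (?G y2) b * k2 x2 y2)"
      by (simp add: mult_ac)
  qed
  also have "\<dots> = (\<integral>\<^sup>+x2. A1 * (\<integral>\<^sup>+y2. ennpowr (?F x2) a * ennpowr (?G y2) b * k2 x2 y2 \<partial>N2) \<partial>M2)"
    by (intro nn_integral_cong nn_integral_cmult) measurable
  also have "\<dots> = A1 * (\<integral>\<^sup>+x2. \<integral>\<^sup>+y2. ennpowr (?F x2) a * ennpowr (?G y2) b * k2 x2 y2 \<partial>N2 \<partial>M2)"
    by (intro nn_integral_cmult) measurable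
  also have "\<dots> \<le> A1 * (A2 * ennpowr (\<integral>\<^sup>+x2. ?F x2 \<partial>M2) a * ennpowr (\<integral>\<^sup>+y2. ?G y2 \<partial>N2) b)"
    by (intro mult_left_mono bilinear_boundD[OF b2]) auto
  also have "(\<integral>\<^sup>+x2. ?F x2 \<partial>M2) = (\<integral>\<^sup>+x. F x \<partial>(M1 \<Otimes>\<^sub>M M2))"
    by (rule M12.nn_integral_snd) measurable
  also have "(\<integral>\<^sup>+y2. ?G y2 \<partial>N2) = (\<integral>\<^sup>+y. G y \<partial>(N1 \<Otimes>\<^sub>M N2))"
    by (rule N12.nn_integral_snd) measurable
  finally show "(\<integral>\<^sup>+x. \<integral>\<^sup>+y. ?h x y \<partial>(N1 \<Otimes>\<^sub>M N2) \<partial>(M1 \<Otimes>\<^sub>M M2)) \<le>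
      A1 * A2 * ennpowr (\<integral>\<^sup>+x. F x \<partial>(M1 \<Otimes>\<^sub>M M2)) a * ennpowr (\<integral>\<^sup>+y. G y \<partial>(N1 \<Otimes>\<^sub>M N2)) b"
    by (simp add: mult_ac)
qed

lemma bilinear_bound_distr:
  fixes \<phi> :: "'a \<Rightarrow> 'b" and \<psi> :: "'c \<Rightarrow> 'd" and k :: "'b \<Rightarrow> 'd \<Rightarrow> ennreal"
  assumes [measurable]: "\<phi> \<in> measurable M M'" "\<psi> \<in> measurable N N'"
    and [measurable]: "case_prod k \<in> borel_measurable (M' \<Otimes>\<^sub>M N')" and N': "sigma_finite_measure (distr N N' \<psi>)"
    and bnd: "bilinear_bound a b M N (\<lambda>x y. k (\<phi> x) (\<psi> y)) A"
  shows "bilinear_bound a b (distr M M' \<phi>) (distr N N' \<psi>) k A"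
  unfolding bilinear_bound_def
proof (intro ballI)
  interpret N': sigma_finite_measure "distr N N' \<psi>" by fact
  fix F :: "'b \<Rightarrow> ennreal" and G :: "'d \<Rightarrow> ennreal"
  assume "F \<in> borel_measurable (distr M M' \<phi>)" "G \<in> borel_measurable (distr N N' \<psi>)"
  then have [measurable]: "F \<in> borel_measurable M'" "G \<in> borel_measurable N'" by simp_all
  let ?h = "\<lambda>x y. ennpowr (F x) a * ennpowr (G y) b * k x y"
  have h: "case_prod ?h \<in> borel_measurable (M' \<Otimes>\<^sub>M N')"
    by measurable
  have h1: "(\<lambda>x. \<integral>\<^sup>+y. ?h x y \<partial>distr N N' \<psi>) \<in> borel_measurable M'"
  proof (rule N'.borel_measurable_nn_integral)
    show "case_prod ?h \<in> borel_measurable (M' \<Otimes>\<^sub>M distr N N' \<psi>)"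
      using h by (subst measurable_cong_sets[OF sets_pair_measure_cong[OF refl sets_distr] refl])
  qed
  have "(\<integral>\<^sup>+x. \<integral>\<^sup>+y. ?h x y \<partial>distr N N' \<psi> \<partial>distr M M' \<phi>) = (\<integral>\<^sup>+x. \<integral>\<^sup>+y. ?h (\<phi> x) y \<partial>distr N N' \<psi> \<partial>M)"
    by (rule nn_integral_distr[OF assms(1)]) (simp only: measurable_distr_eq1 h1)
  also have "\<dots> = (\<integral>\<^sup>+x. \<integral>\<^sup>+y. ?h (\<phi> x) (\<psi> y) \<partial>N \<partial>M)"
  proof (rule nn_integral_cong)
    fix x assume "x \<in> space M"
    then have "\<phi> x \<in> space M'"
      using assms(1) by (rule measurable_space[rotated])
    then have "?h (\<phi> x) \<in> borel_measurable N'"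
      using measurable_compose_Pair1[OF _ h, of "\<phi> x"] by (simp only: prod.case)
    then show "(\<integral>\<^sup>+y. ?h (\<phi> x) y \<partial>distr N N' \<psi>) = (\<integral>\<^sup>+y. ?h (\<phi> x) (\<psi> y) \<partial>N)"
      by (intro nn_integral_distr[OF assms(2)]) (simp only: measurable_distr_eq1)
  qed
  also have "\<dots> \<le> A * ennpowr (\<integral>\<^sup>+x. F (\<phi> x) \<partial>M) a * ennpowr (\<integral>\<^sup>+y. G (\<psi> y) \<partial>N) b"
    by (intro bilinear_boundD[OF bnd]) measurable
  also have "(\<integral>\<^sup>+x. F (\<phi> x) \<partial>M) = (\<integral>\<^sup>+x. F x \<partial>distr M M' \<phi>)"
    using nn_integral_distr[of \<phi> M M' F] assms(1) by simp
  also have "(\<integral>\<^sup>+y. G (\<psi> y) \<partial>N) = (\<integral>\<^sup>+y. G y \<partial>distr N N' \<psi>)"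
    using nn_integral_distr[of \<psi> N N' G] assms(2) by simp
  finally show "(\<integral>\<^sup>+x. \<integral>\<^sup>+y. ?h x y \<partial>distr N N' \<psi> \<partial>distr M M' \<phi>)
     \<le> A * ennpowr (\<integral>\<^sup>+x. F x \<partial>distr M M' \<phi>) a * ennpowr (\<integral>\<^sup>+y. G y \<partial>distr N N' \<psi>) b" .
qed

lemma bilinear_bound_mono:
  fixes k :: "'a \<Rightarrow> 'b \<Rightarrow> ennreal"
  assumes "bilinear_bound a b M N k A" "\<And>x y. k' x y \<le> k x y"
  shows "bilinear_bound a b M N k' A"
  unfolding bilinear_bound_def
proof (intro ballI)
  fix F :: "'a \<Rightarrow> ennreal" and G :: "'b \<Rightarrow> ennreal"
  assume FG: "F \<in> borel_measurable M" "G \<in> borel_measurable N"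
  have "(\<integral>\<^sup>+x. \<integral>\<^sup>+y. ennpowr (F x) a * ennpowr (G y) b * k' x y \<partial>N \<partial>M)
    \<le> (\<integral>\<^sup>+x. \<integral>\<^sup>+y. ennpowr (F x) a * ennpowr (G y) b * k x y \<partial>N \<partial>M)"
    by (intro nn_integral_mono mult_left_mono assms) auto
  also note bilinear_boundD[OF assms(1) FG]
  finally show "(\<integral>\<^sup>+x. \<integral>\<^sup>+y. ennpowr (F x) a * ennpowr (G y) b * k' x y \<partial>N \<partial>M)
    \<le> A * ennpowr (\<integral>\<^sup>+x. F x \<partial>M) a * ennpowr (\<integral>\<^sup>+y. G y \<partial>N) b" .
qed

text \<open>Testing with \<open>G = J^q\<close> would bound the integral of \<open>J^q\<close> by
  \<open>B\<close> times its power \<open>1 - 1/q\<close>, and dividing would finish; but the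
  division needs a finite integral. Hence truncations of \<open>J^q\<close> in height and support
  are tested instead, for which \<open>G = G^(1/q) G^(1-1/q)\<close> is at most
  \<open>J G^(1-1/q)\<close>, and monotone convergence removes the truncation.\<close>

lemma (in sigma_finite_measure) nn_integral_powr_le_of_dual:
  assumes [measurable]: "J \<in> borel_measurable M" and q: "1 < q"
    and dual: "\<And>G. G \<in> borel_measurable M \<Longrightarrow>
      (\<integral>\<^sup>+x. J x * ennpowr (G x) (1 - 1 / q) \<partial>M) \<le> B * ennpowr (\<integral>\<^sup>+x. G x \<partial>M) (1 - 1 / q)"
  shows "(\<integral>\<^sup>+x. ennpowr (J x) q \<partial>M) \<le> ennpowr B q"
proof (cases "B = top")
  case True
  then show ?thesis by simp
next
  case False
  then obtain B' where B': "B = ennreal B'" "B' \<ge> 0"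
    by (metis ennreal_cases)
  obtain A :: "nat \<Rightarrow> 'a set" where A: "range A \<subseteq> sets M" "(\<Union>i. A i) = space M"
      "\<And>i. emeasure M (A i) \<noteq> \<infinity>" "incseq A"
    using sigma_finite_incseq by blast
  have [measurable]: "A i \<in> sets M" for i
    using A by auto
  define G where "G n x = min (ennpowr (J x) q) (of_nat n) * indicator (A n) x" for n x
  have [measurable]: "G n \<in> borel_measurable M" for n
    unfolding G_def by measurable
  have le: "(\<integral>\<^sup>+x. G n x \<partial>M) \<le> ennpowr B q" for n
  proof -
    have "(\<integral>\<^sup>+x. G n x \<partial>M) \<le> (\<integral>\<^sup>+x. of_nat n * indicator (A n) x \<partial>M)"
      by (intro nn_integral_mono) (auto simp: G_def indicator_def)
    also have "\<dots> = of_nat n * emeasure M (A n)"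
      by (simp add: nn_integral_cmult_indicator)
    also have "\<dots> < top"
      using A(3)[of n] by (simp add: ennreal_mult_less_top less_top of_nat_less_top)
    finally obtain r where r: "(\<integral>\<^sup>+x. G n x \<partial>M) = ennreal r" "r \<ge> 0"
      by (metis ennreal_cases less_irrefl)
    have "G n x \<le> J x * ennpowr (G n x) (1 - 1 / q)" for x
    proof -
      have fin: "G n x \<noteq> top"
        using of_nat_less_top[of n] by (auto simp: G_def indicator_def min_def top_unique)
      have "G n x = ennpowr (G n x) (1 / q) * ennpowr (G n x) (1 - 1 / q)"
        using fin by (cases "G n x") (auto simp flip: ennreal_mult powr_add)
      also have "ennpowr (G n x) (1 / q) \<le> ennpowr (ennpowr (J x) q) (1 / q)"
        using q by (intro ennpowr_mono) (auto simp: G_def indicator_def)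
      also have "\<dots> = J x"
        using q by (cases "J x") (auto simp: powr_powr)
      finally show ?thesis
        by (simp add: mult_right_mono)
    qed
    then have "ennreal r \<le> (\<integral>\<^sup>+x. J x * ennpowr (G n x) (1 - 1 / q) \<partial>M)"
      unfolding r(1)[symmetric] by (rule nn_integral_mono)
    also have "\<dots> \<le> B * ennpowr (ennreal r) (1 - 1 / q)"
      using dual[of "G n"] by (simp add: r)
    also have "\<dots> = ennreal (B' * r powr (1 - 1 / q))"
      using B' r by (simp add: ennreal_mult)
    finally have *: "r \<le> B' * r powr (1 - 1 / q)"
      using B' by (subst (asm) ennreal_le_iff) auto
    have "r \<le> B' powr q"
    proof (cases "r = 0")
      case False
      then have "r > 0" using r by simp
      then have "r powr (1 / q) \<le> B'"
        using * by (simp add: powr_diff field_simps)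
      then have "(r powr (1 / q)) powr q \<le> B' powr q"
        using q by (intro powr_mono2) auto
      then show ?thesis
        using q r by (simp add: powr_powr)
    qed simp
    then show ?thesis
      using r B' by (simp add: ennreal_leI)
  qed
  have "(SUP n. G n x) = ennpowr (J x) q" if x: "x \<in> space M" for x
  proof (rule antisym)
    show "(SUP n. G n x) \<le> ennpowr (J x) q"
      by (intro SUP_least) (auto simp: G_def indicator_def)
    show "ennpowr (J x) q \<le> (SUP n. G n x)"
    \<comment> \<open>Working with \<open>y\<close> strictly below the target keeps \<open>y\<close>
      finite even where \<open>J x\<close> is \<open>top\<close>, so that some truncation height
      exceeds it.\<close>
    proof (rule dense_le)
      fix y assume y: "y < ennpowr (J x) q"
      then have "y < top"
        by (metis less_top top.not_eq_extremum order.strict_trans)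
      then obtain n where n: "y < of_nat n"
        using ennreal_Ex_less_of_nat by blast
      obtain m where m: "x \<in> A m"
        using A x by blast
      have "y \<le> min (ennpowr (J x) q) (of_nat (max m n))"
        using y n by (auto simp: less_imp_le max_def intro: order.trans[OF less_imp_le])
      moreover have "x \<in> A (max m n)"
        using m \<open>incseq A\<close> by (meson incseqD max.cobounded1 subsetD)
      ultimately have "y \<le> G (max m n) x"
        by (simp add: G_def)
      then show "y \<le> (SUP n. G n x)"
        by (rule SUP_upper2[OF UNIV_I])
    qed
  qed
  then have "(\<integral>\<^sup>+x. ennpowr (J x) q \<partial>M) = (\<integral>\<^sup>+x. (SUP n. G n x) \<partial>M)"
    by (intro nn_integral_cong) simp
  also have "\<dots> = (SUP n. \<integral>\<^sup>+x. G n x \<partial>M)"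
  proof (rule nn_integral_monotone_convergence_SUP)
    show "incseq G"
      unfolding incseq_def le_fun_def G_def
    proof (intro allI impI mult_mono)
      fix m n :: nat and x assume "m \<le> n"
      then show "min (ennpowr (J x) q) (of_nat m) \<le> min (ennpowr (J x) q) (of_nat n)"
        by (intro min.mono) auto
      show "indicator (A m) x \<le> (indicator (A n) x :: ennreal)"
        using \<open>m \<le> n\<close> \<open>incseq A\<close> by (auto simp: indicator_def incseq_def)
    qed auto
  qed auto
  also have "\<dots> \<le> ennpowr B q"
    by (intro SUP_least le)
  finally show ?thesis .
qed

subsection \<open>The Hardy--Littlewood--Sobolev inequality on the line\<close>

lemma nn_integral_abs_diff:
  fixes \<phi> :: "real \<Rightarrow> ennreal"
  assumes [measurable]: "\<phi> \<in> borel_measurable borel"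
  shows "(\<integral>\<^sup>+y. \<phi> \<bar>x - y\<bar> \<partial>lborel) = 2 * (\<integral>\<^sup>+z. \<phi> z * indicator {0..} z \<partial>lborel)"
proof -
  have "(\<integral>\<^sup>+y. \<phi> \<bar>x - y\<bar> \<partial>lborel) = (\<integral>\<^sup>+z. \<phi> \<bar>z\<bar> \<partial>lborel)"
    by (subst nn_integral_real_affine[where t = x and c = "-1"]) auto
  also have "\<dots> = (\<integral>\<^sup>+z. \<phi> z * indicator {0..} z + \<phi> (- z) * indicator {..<0} z \<partial>lborel)"
    by (intro nn_integral_cong) (auto simp: indicator_def)
  also have "\<dots> = (\<integral>\<^sup>+z. \<phi> z * indicator {0..} z \<partial>lborel) + (\<integral>\<^sup>+z. \<phi> (- z) * indicator {..<0} z \<partial>lborel)"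
    by (rule nn_integral_add) auto
  also have "(\<integral>\<^sup>+z. \<phi> (- z) * indicator {..<0} z \<partial>lborel) = (\<integral>\<^sup>+z. \<phi> z * indicator {..<0} (- z) \<partial>lborel)"
    by (subst nn_integral_real_affine[where t = 0 and c = "-1"]) auto
  \<comment> \<open>After the reflection the two half-lines differ only in the origin, a null
    set.\<close>
  also have "\<dots> = (\<integral>\<^sup>+z. \<phi> z * indicator {0..} z \<partial>lborel)"
    by (rule nn_integral_cong_AE, use AE_lborel_singleton[of "0::real"] in eventually_elim)
       (auto simp: indicator_def)
  finally show ?thesis
    by (simp add: mult_2)
qed

lemma nn_integral_powr_near:
  assumes "l < 1" "0 \<le> d"
  shows "(\<integral>\<^sup>+y. ennreal (\<bar>x - y\<bar> powr (- l)) * indicator {..d} \<bar>x - y\<bar> \<partial>lborel)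
    = ennreal (2 * (d powr (1 - l) / (1 - l)))"
proof -
  have "(\<integral>\<^sup>+z. ennreal (z powr (- l)) * indicator {..d} z * indicator {0..} z \<partial>lborel)
      = (\<integral>\<^sup>+z. ennreal (z powr (- l)) * indicator {0..d} z \<partial>lborel)"
    by (intro nn_integral_cong) (auto simp: indicator_def)
  also have "\<dots> = ennreal (d powr (- l + 1) / (- l + 1))"
    using assms by (intro nn_integral_has_integral_lebesgue' has_integral_powr_from_0) auto
  also have "- l + 1 = 1 - l"
    by simp
  finally show ?thesis
    using assms ennreal_mult[of 2 "d powr (1 - l) / (1 - l)"]
    by (subst nn_integral_abs_diff[where \<phi> = "\<lambda>z. ennreal (z powr (- l)) * indicator {..d} z"]) auto
qed

lemma nn_integral_powr_far:
  assumes "1 < m" "0 < d"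
  shows "(\<integral>\<^sup>+y. ennreal (\<bar>x - y\<bar> powr (- m)) * indicator {d..} \<bar>x - y\<bar> \<partial>lborel)
    = ennreal (2 * (d powr (1 - m) / (m - 1)))"
proof -
  have "(\<integral>\<^sup>+z. ennreal (z powr (- m)) * indicator {d..} z * indicator {0..} z \<partial>lborel)
      = (\<integral>\<^sup>+z. ennreal (z powr (- m)) * indicator {d..} z \<partial>lborel)"
    using assms by (intro nn_integral_cong) (auto simp: indicator_def)
  also have "\<dots> = ennreal (- (d powr (- m + 1)) / (- m + 1))"
    using assms by (intro nn_integral_has_integral_lebesgue' has_integral_powr_to_inf) auto
  also have "- (d powr (- m + 1)) / (- m + 1) = d powr (1 - m) / (m - 1)"
    using assms minus_divide_divide[of "d powr (1 - m)" "m - 1"] by simp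
  finally show ?thesis
    using assms ennreal_mult[of 2 "d powr (1 - m) / (m - 1)"]
    by (subst nn_integral_abs_diff[where \<phi> = "\<lambda>z. ennreal (z powr (- m)) * indicator {d..} z"]) auto
qed

text \<open>Here \<open>A\<close> stands for \<open>F x\<close>, \<open>g\<close> for
  \<open>G y\<close> and \<open>z\<close> for the distance. Near the diagonal \<open>A^a g^b\<close>
  is at most \<open>A^(a+b) = A * A^(1-l)\<close>. The right-hand side is arranged so that each
  summand inside the bracket integrates in \<open>y\<close> to a constant independent of
  \<open>A\<close>.\<close>

lemma near_far_bound:
  fixes A g z a b l :: real
  assumes A: "0 < A" and g: "0 \<le> g" "z \<le> 1 / A \<Longrightarrow> g \<le> A" and z: "0 \<le> z"
    and ab: "0 < b" "b < 1" "a + b + l = 2"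
  shows "A powr a * g powr b * z powr (- l) \<le>
     A * (A powr (1 - l) * (z powr (- l) * indicator {..1 / A} z)
       + (b * g + (1 - b) * (A powr ((a - 1) / (1 - b)) * (z powr (- (l / (1 - b))) * indicator {1 / A..} z))))"
proof (cases "z \<le> 1 / A")
  case True
  have "A powr a * g powr b * z powr (- l) \<le> A powr a * A powr b * z powr (- l)"
    using g(2)[OF True] g(1) ab by (intro mult_right_mono mult_left_mono powr_mono2) auto
  also have "A powr a * A powr b = A * A powr (1 - l)"
  proof -
    have "a + b = 1 + (1 - l)"
      using ab by simp
    then show ?thesis
      using A by (simp only: powr_mult_base less_imp_le flip: powr_add)
  qed
  finally have "A powr a * g powr b * z powr (- l) \<le> A * (A powr (1 - l) * (z powr (- l) * indicator {..1 / A} z))"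
    using True by (simp add: mult_ac)
  moreover have "0 \<le> A * (b * g + (1 - b) * (A powr ((a - 1) / (1 - b)) * (z powr (- (l / (1 - b))) * indicator {1 / A..} z)))"
    using ab A g by auto
  ultimately show ?thesis
    by (simp only: distrib_left)
next
  case False
  \<comment> \<open>After a factor \<open>A\<close> is taken out, Young's inequality with exponents
    \<open>1/b\<close> and \<open>1/(1-b)\<close> separates \<open>g^b\<close> from
    \<open>w\<close>; the density then enters linearly and contributes only its mass.\<close>
  define w where "w = A powr (a - 1) * z powr (- l)"
  have "g powr b * w \<le> (g powr b) powr (1 / b) / (1 / b) + w powr (1 / (1 - b)) / (1 / (1 - b))"
    using ab by (intro Youngs_inequality) (auto simp: w_def divide_simps)
  also have "\<dots> = b * g + (1 - b) * w powr (1 / (1 - b))"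
    using ab g by (simp add: powr_powr)
  finally have "A * (g powr b * w) \<le> A * (b * g + (1 - b) * w powr (1 / (1 - b)))"
    using A by simp
  also have "A * (g powr b * w) = A powr a * g powr b * z powr (- l)"
    using A by (simp add: w_def powr_diff)
  also have "w powr (1 / (1 - b)) = A powr ((a - 1) / (1 - b)) * z powr (- (l / (1 - b)))"
    using z A by (simp add: w_def powr_mult powr_powr)
  finally show ?thesis
    using False by simp
qed

lemma slice_bound:
  fixes G :: "real \<Rightarrow> ennreal" and a b l :: real
  assumes [measurable]: "G \<in> borel_measurable borel" and G: "(\<integral>\<^sup>+y. G y \<partial>lborel) = 1"
    and ab: "0 < a" "a < 1" "0 < b" "b < 1" "l < 1" "a + b + l = 2"
  shows "(\<integral>\<^sup>+y. ennpowr A a * ennpowr (G y) b * ennreal (\<bar>x - y\<bar> powr (- l)) * indicator {..A} (G y) \<partial>lborel)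
     \<le> ennreal (2 / (1 - l) + b + 2 * (1 - b) / (l / (1 - b) - 1)) * A"
proof -
  define m where "m = l / (1 - b)"
  \<comment> \<open>Since \<open>a + b + l = 2\<close>, the inequality \<open>l > 1 - b\<close> is
    \<open>a < 1\<close>. It makes the tail integrable.\<close>
  have m: "m > 1"
    using ab by (simp add: m_def)
  \<comment> \<open>One summand for each term of \<open>near_far_bound\<close>: the singularity, the
    mass of \<open>G\<close> weighted by \<open>b\<close>, and the tail.\<close>
  define C where "C = 2 / (1 - l) + b + 2 * (1 - b) / (m - 1)"
  have C: "C > 0"
    using ab m by (auto simp: C_def intro!: add_pos_nonneg)
  consider "A = 0" | "A = top" | r where "A = ennreal r" "r > 0"
    by (metis ennreal_cases ennreal_0 less_eq_real_def)
  then have "(\<integral>\<^sup>+y. ennpowr A a * ennpowr (G y) b * ennreal (\<bar>x - y\<bar> powr (- l)) * indicator {..A} (G y) \<partial>lborel) \<le> ennreal C * A"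
  proof cases
    case 1
    then show ?thesis by simp
  next
    case 2
    then show ?thesis using C by (simp add: ennreal_mult_top)
  next
    case (3 r)
    let ?n = "\<lambda>y. ennreal (\<bar>x - y\<bar> powr (- l)) * indicator {..1 / r} \<bar>x - y\<bar>"
    let ?f = "\<lambda>y. ennreal (\<bar>x - y\<bar> powr (- m)) * indicator {1 / r..} \<bar>x - y\<bar>"
    let ?e = "r powr ((a - 1) / (1 - b))"
    have "ennpowr A a * ennpowr (G y) b * ennreal (\<bar>x - y\<bar> powr (- l)) * indicator {..A} (G y)
      \<le> ennreal r * (ennreal (r powr (1 - l)) * ?n y + (ennreal b * G y + ennreal (1 - b) * (ennreal ?e * ?f y)))"
      (is "?L \<le> ?R") for y
    proof (cases "G y \<le> A")
      case True
      then obtain g where g: "G y = ennreal g" "0 \<le> g" "g \<le> r"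
        using 3 by (cases "G y") (auto simp: top_unique)
      have "?L = ennreal (r powr a * g powr b * \<bar>x - y\<bar> powr (- l))"
        using 3 g True by (simp add: ennreal_mult)
      also have "\<dots> \<le> ennreal (r * (r powr (1 - l) * (\<bar>x - y\<bar> powr (- l) * indicator {..1 / r} \<bar>x - y\<bar>)
       + (b * g + (1 - b) * (?e * (\<bar>x - y\<bar> powr (- m) * indicator {1 / r..} \<bar>x - y\<bar>)))))"
        unfolding m_def using 3 g ab by (intro ennreal_leI near_far_bound) auto
      also have "\<dots> = ?R"
        using 3 g ab by (simp add: ennreal_mult ennreal_plus ennreal_indicator[symmetric] del: ennreal_indicator)
      finally show ?thesis .
    qed simp
    then have "(\<integral>\<^sup>+y. ennpowr A a * ennpowr (G y) b * ennreal (\<bar>x - y\<bar> powr (- l)) * indicator {..A} (G y) \<partial>lborel)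
      \<le> (\<integral>\<^sup>+y. ennreal r * (ennreal (r powr (1 - l)) * ?n y + (ennreal b * G y + ennreal (1 - b) * (ennreal ?e * ?f y))) \<partial>lborel)"
      by (intro nn_integral_mono)
    also have "\<dots> = ennreal r * (ennreal (r powr (1 - l)) * (\<integral>\<^sup>+y. ?n y \<partial>lborel) + (ennreal b * (\<integral>\<^sup>+y. G y \<partial>lborel)
        + ennreal (1 - b) * (ennreal ?e * (\<integral>\<^sup>+y. ?f y \<partial>lborel))))"
      by (simp add: nn_integral_add nn_integral_cmult)
    also have "\<dots> = ennreal r * (ennreal (r powr (1 - l)) * ennreal (2 * ((1 / r) powr (1 - l) / (1 - l)))
        + (ennreal b + ennreal (1 - b) * (ennreal ?e * ennreal (2 * ((1 / r) powr (1 - m) / (m - 1))))))"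
      using 3 ab m by (simp only: G nn_integral_powr_near nn_integral_powr_far mult_1_right divide_nonneg_pos
          zero_less_divide_1_iff less_imp_le zero_le_divide_1_iff)
    also have "\<dots> = ennreal (r * (r powr (1 - l) * (2 * ((1 / r) powr (1 - l) / (1 - l))) + (b + (1 - b) * (?e * (2 * ((1 / r) powr (1 - m) / (m - 1)))))))"
      using 3 ab m by (simp add: ennreal_mult ennreal_plus del: times_divide_eq_right times_divide_eq_left)
    also have "r powr (1 - l) * (2 * ((1 / r) powr (1 - l) / (1 - l))) = 2 / (1 - l)"
      using 3 by (simp add: powr_divide)
    also have "?e * (2 * ((1 / r) powr (1 - m) / (m - 1))) = (r powr ((a - 1) / (1 - b)) * r powr (m - 1)) * (2 / (m - 1))"
      using 3 by (simp add: powr_divide powr_diff)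
    also have "r powr ((a - 1) / (1 - b)) * r powr (m - 1) = r powr ((a - 1) / (1 - b) + (m - 1))"
      by (simp add: powr_add)
    \<comment> \<open>Scale invariance: by \<open>a + b + l = 2\<close> the power of
      \<open>r\<close> from Young's inequality cancels the one from cutting the tail at
      \<open>1 / r\<close>.\<close>
    also have "(a - 1) / (1 - b) + (m - 1) = 0"
    proof -
      have "m - 1 = (l - (1 - b)) / (1 - b)"
        using ab by (simp add: m_def diff_divide_distrib)
      then have "(a - 1) / (1 - b) + (m - 1) = (a - 1 + (l - (1 - b))) / (1 - b)"
        by (simp only: add_divide_distrib)
      also have "a - 1 + (l - (1 - b)) = 0"
        using ab by simp
      finally show ?thesis by simp
    qed
    finally show ?thesis
      using 3 C by (simp add: C_def ennreal_mult' [symmetric] mult_ac add_ac)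
  qed
  then show ?thesis
    by (simp add: C_def m_def)
qed

text \<open>Normalize \<open>\<integral> F = \<integral> G = 1\<close>. Where \<open>G y \<le> F x\<close>, split at \<open>\<bar>x - y\<bar> = 1 / F x\<close>: near the diagonal
  bound \<open>G y\<close> by \<open>F x\<close>, away from it use Young's inequality; integration in \<open>y\<close> leaves a multiple
  of \<open>F x\<close>. The region \<open>F x \<le> G y\<close> is symmetric.\<close>

theorem hardy_littlewood_sobolev_real:
  fixes a b l :: real
  assumes ab: "0 < a" "a < 1" "0 < b" "b < 1" "l < 1" "a + b + l = 2"
  shows "\<exists>C>0. bilinear_bound a b lborel lborel (\<lambda>x y :: real. ennreal (\<bar>x - y\<bar> powr (- l))) (ennreal C)"
proof -
  define C :: "real \<Rightarrow> real" where "C b = 2 / (1 - l) + b + 2 * (1 - b) / (l / (1 - b) - 1)" for b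
  have C: "C a > 0" "C b > 0"
  proof -
    have "l / (1 - a) > 1" "l / (1 - b) > 1"
      using ab by simp_all
    then show "C a > 0" "C b > 0"
      using ab by (auto simp: C_def intro!: add_pos_nonneg)
  qed
  have "bilinear_bound a b lborel lborel (\<lambda>x y :: real. ennreal (\<bar>x - y\<bar> powr (- l))) (ennreal (C b + C a))"
  proof (rule bilinear_bound_normalized)
    show "ennreal (C b + C a) \<noteq> 0"
      using C by simp
    fix F G :: "real \<Rightarrow> ennreal"
    assume "F \<in> borel_measurable lborel" "G \<in> borel_measurable lborel"
      and F: "(\<integral>\<^sup>+x. F x \<partial>lborel) = 1" and G: "(\<integral>\<^sup>+y. G y \<partial>lborel) = 1"
    then have [measurable]: "F \<in> borel_measurable borel" "G \<in> borel_measurable borel"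
      by simp_all
    define K where "K x y = ennpowr (F x) a * ennpowr (G y) b * ennreal (\<bar>x - y\<bar> powr (- l))" for x y
    have [measurable]: "(\<lambda>(x, y). K x y) \<in> borel_measurable (borel \<Otimes>\<^sub>M borel)"
      unfolding K_def by measurable
    have [measurable]: "(\<lambda>(x, y). indicator {..F x} (G y) :: ennreal) \<in> borel_measurable (borel \<Otimes>\<^sub>M borel)"
        "(\<lambda>(x, y). indicator {..G y} (F x) :: ennreal) \<in> borel_measurable (borel \<Otimes>\<^sub>M borel)"
      unfolding indicator_def by simp_all
    \<comment> \<open>The two regions cover the plane; they overlap only where
      \<open>F x = G y\<close>, and counting that set twice is harmless for an upper bound.\<close>
    have "(\<integral>\<^sup>+x. \<integral>\<^sup>+y. K x y \<partial>lborel \<partial>lborel) \<le>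
        (\<integral>\<^sup>+x. \<integral>\<^sup>+y. K x y * indicator {..F x} (G y) + K x y * indicator {..G y} (F x) \<partial>lborel \<partial>lborel)"
      by (intro nn_integral_mono) (auto simp: indicator_def)
    also have "\<dots> = (\<integral>\<^sup>+x. \<integral>\<^sup>+y. K x y * indicator {..F x} (G y) \<partial>lborel \<partial>lborel)
        + (\<integral>\<^sup>+x. \<integral>\<^sup>+y. K x y * indicator {..G y} (F x) \<partial>lborel \<partial>lborel)"
      by (simp add: nn_integral_add)
    also have "(\<integral>\<^sup>+x. \<integral>\<^sup>+y. K x y * indicator {..G y} (F x) \<partial>lborel \<partial>lborel)
        = (\<integral>\<^sup>+y. \<integral>\<^sup>+x. K x y * indicator {..G y} (F x) \<partial>lborel \<partial>lborel)"
      by (rule lborel_pair.Fubini'[symmetric]) measurable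
    also have "(\<integral>\<^sup>+x. \<integral>\<^sup>+y. K x y * indicator {..F x} (G y) \<partial>lborel \<partial>lborel) \<le> (\<integral>\<^sup>+x. ennreal (C b) * F x \<partial>lborel)"
      unfolding K_def C_def using ab by (intro nn_integral_mono slice_bound[OF _ G]) auto
    also have "\<dots> = ennreal (C b)"
      by (simp add: nn_integral_cmult F)
    also have "(\<integral>\<^sup>+y. \<integral>\<^sup>+x. K x y * indicator {..G y} (F x) \<partial>lborel \<partial>lborel) \<le> (\<integral>\<^sup>+y. ennreal (C a) * G y \<partial>lborel)"
    proof (rule nn_integral_mono)
      \<comment> \<open>The slice estimate with \<open>F\<close> and \<open>G\<close>, and hence
        \<open>a\<close> and \<open>b\<close>, exchanged; this is why the constant is
        \<open>C a\<close>.\<close>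
      fix y :: real
      have "(\<integral>\<^sup>+x. K x y * indicator {..G y} (F x) \<partial>lborel) =
        (\<integral>\<^sup>+x. ennpowr (G y) b * ennpowr (F x) a * ennreal (\<bar>y - x\<bar> powr (- l)) * indicator {..G y} (F x) \<partial>lborel)"
        by (simp add: K_def mult_ac abs_minus_commute)
      also have "\<dots> \<le> ennreal (C a) * G y"
        unfolding C_def using ab by (intro slice_bound[OF _ F]) auto
      finally show "(\<integral>\<^sup>+x. K x y * indicator {..G y} (F x) \<partial>lborel) \<le> ennreal (C a) * G y" .
    qed
    also have "\<dots> = ennreal (C a)"
      by (simp add: nn_integral_cmult G)
    finally show "(\<integral>\<^sup>+x. \<integral>\<^sup>+y. ennpowr (F x) a * ennpowr (G y) b * ennreal (\<bar>x - y\<bar> powr (- l)) \<partial>lborel \<partial>lborel)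
        \<le> ennreal (C b + C a)"
      using C by (simp add: K_def ennreal_plus add_mono)
  qed (use lborel.sigma_finite_measure_axioms in auto)
  then show ?thesis
    using C by (intro exI[of _ "C b + C a"]) auto
qed

subsection \<open>Product kernels on three-dimensional space\<close>

definition vec_of_triple :: "real \<times> real \<times> real \<Rightarrow> real^3" where
  "vec_of_triple t = vector [fst t, fst (snd t), snd (snd t)]"

lemma vec_of_triple_nth [simp]:
  "vec_of_triple t $ 1 = fst t" "vec_of_triple t $ 2 = fst (snd t)" "vec_of_triple t $ 3 = snd (snd t)"
  by (simp_all add: vec_of_triple_def)

lemma measurable_vec_of_triple [measurable]: "vec_of_triple \<in> borel_measurable borel"
proof (rule borel_measurable_continuous_onI)
  have eq: "vec_of_triple t = fst t *\<^sub>R axis 1 1 + fst (snd t) *\<^sub>R axis 2 1 + snd (snd t) *\<^sub>R axis 3 1" for t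
    by (simp add: vec_eq_iff forall_3) (simp add: axis_def)
  show "continuous_on UNIV vec_of_triple"
    unfolding eq by (intro continuous_intros)
qed

lemma emeasure_lborel_times:
  fixes A :: "'a::euclidean_space set" and B :: "'b::euclidean_space set"
  assumes "open A" "open B"
  shows "emeasure lborel (A \<times> B) = emeasure lborel A * emeasure lborel B"
  using assms lborel.emeasure_pair_measure_Times[of A lborel B] by (simp add: lborel_prod)

text \<open>Lebesgue measure is determined by its values on boxes, and the preimage of a box is a
  product of intervals. This carries the tensor bound, proved on nested pairs, over to
  \<open>real^3\<close>.\<close>

lemma lborel_eq_distr_vec_of_triple: "lborel = distr lborel borel vec_of_triple"
proof (rule lborel_eqI)
  fix l u :: "real^3"
  assume le_Basis: "\<And>b. b \<in> Basis \<Longrightarrow> l \<bullet> b \<le> u \<bullet> b"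
  have le: "l $ i \<le> u $ i" for i
    using le_Basis[of "axis i 1"] by (simp add: inner_axis)
  have "emeasure (distr lborel borel vec_of_triple) (box l u) = emeasure lborel (vec_of_triple -` box l u)"
    by (simp add: emeasure_distr)
  also have "vec_of_triple -` box l u = {l$1<..<u$1} \<times> ({l$2<..<u$2} \<times> {l$3<..<u$3})"
    by (auto simp: mem_box_cart forall_3)
  also have "emeasure lborel \<dots> = ennreal ((u$1 - l$1) * ((u$2 - l$2) * (u$3 - l$3)))"
    by (simp add: emeasure_lborel_times open_Times le ennreal_mult)
  also have "(u$1 - l$1) * ((u$2 - l$2) * (u$3 - l$3)) = (\<Prod>i\<in>UNIV. (u - l) $ i)"
    unfolding UNIV_3 by simp
  also have "\<dots> = (\<Prod>b\<in>Basis. (u - l) \<bullet> b)"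
    by (simp add: Basis_vec_def inner_axis axis_eq_axis prod.UNION_disjoint)
  finally show "emeasure (distr lborel borel vec_of_triple) (box l u) = ennreal (\<Prod>b\<in>Basis. (u - l) \<bullet> b)" .
qed simp

definition riesz_product :: "real \<Rightarrow> real^3 \<Rightarrow> real" where
  "riesz_product l x = \<bar>x$1\<bar> powr (- l) * \<bar>x$2\<bar> powr (- l) * \<bar>x$3\<bar> powr (- l)"

lemma measurable_vec_nth_real [measurable]: "(\<lambda>x :: real^3. x $ i) \<in> borel_measurable borel"
  by (intro borel_measurable_continuous_onI continuous_intros)

lemma hardy_littlewood_sobolev_product:
  fixes a b l :: real
  assumes ab: "0 < a" "a < 1" "0 < b" "b < 1" "l < 1" "a + b + l = 2"
  shows "\<exists>C>0. bilinear_bound a b lborel lborel (\<lambda>x y. ennreal (riesz_product l (x - y))) (ennreal C)"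
proof -
  obtain C where C: "C > 0"
    and b1: "bilinear_bound a b lborel lborel (\<lambda>x y :: real. ennreal (\<bar>x - y\<bar> powr (- l))) (ennreal C)"
    using hardy_littlewood_sobolev_real[OF ab] by blast
  let ?k = "\<lambda>x y :: real. ennreal (\<bar>x - y\<bar> powr (- l))"
  let ?k2 = "\<lambda>x y. ?k (fst x) (fst y) * ?k (snd x) (snd y)"
  let ?k3 = "\<lambda>x y. ?k (fst x) (fst y) * ?k2 (snd x) (snd y)"
  have m1: "case_prod ?k \<in> borel_measurable (lborel \<Otimes>\<^sub>M lborel)"
    by simp
  note sf = lborel.sigma_finite_measure_axioms
  have "bilinear_bound a b (lborel \<Otimes>\<^sub>M lborel) (lborel \<Otimes>\<^sub>M lborel) ?k2 (ennreal C * ennreal C)"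
    by (intro bilinear_bound_tensor[OF sf sf sf sf] b1 m1)
  then have b2: "bilinear_bound a b lborel lborel ?k2 (ennreal C * ennreal C)"
    by (simp only: lborel_prod)
  have [measurable]: "(\<lambda>z :: (real \<times> real) \<times> real \<times> real. fst (fst z) - fst (snd z)) \<in> borel_measurable borel"
      "(\<lambda>z :: (real \<times> real) \<times> real \<times> real. snd (fst z) - snd (snd z)) \<in> borel_measurable borel"
    by (intro borel_measurable_continuous_onI continuous_intros)+
  have m2: "case_prod ?k2 \<in> borel_measurable (lborel \<Otimes>\<^sub>M lborel)"
    by (simp add: lborel_prod case_prod_beta)
  have "bilinear_bound a b (lborel \<Otimes>\<^sub>M lborel) (lborel \<Otimes>\<^sub>M lborel) ?k3 (ennreal C * (ennreal C * ennreal C))"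
    by (intro bilinear_bound_tensor[OF sf sf sf sf] b1 b2 m1 m2)
  then have b3: "bilinear_bound a b lborel lborel ?k3 (ennreal (C * C * C))"
    using C by (simp only: lborel_prod ennreal_mult mult.assoc less_imp_le mult_nonneg_nonneg)
  have "bilinear_bound a b (distr lborel borel vec_of_triple) (distr lborel borel vec_of_triple)
      (\<lambda>x y. ennreal (riesz_product l (x - y))) (ennreal (C * C * C))"
  proof (rule bilinear_bound_distr)
    show "sigma_finite_measure (distr lborel borel vec_of_triple)"
      using sf by (simp only: lborel_eq_distr_vec_of_triple[symmetric])
    show "bilinear_bound a b lborel lborel
      (\<lambda>x y. ennreal (riesz_product l (vec_of_triple x - vec_of_triple y))) (ennreal (C * C * C))"
      using b3 by (simp add: riesz_product_def ennreal_mult mult.assoc)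
  qed (auto simp: riesz_product_def)
  then show ?thesis
    using C by (intro exI[of _ "C * C * C"]) (simp add: lborel_eq_distr_vec_of_triple[symmetric])
qed

text \<open>The bracket dominates \<open>(\<bar>x\<^sub>3\<bar> / (\<bar>x\<^sub>1\<bar> \<bar>x\<^sub>2\<bar>))\<close> to any power in \<open>[-1, 1]\<close>; the power \<open>(\<beta> - \<alpha>) / 2\<close>
  equalizes the three exponents.\<close>

lemma V_le_riesz_product:
  assumes "-1 < \<alpha>" "\<alpha> < 1" "-1 < \<beta>" "\<beta> < 1"
  shows "V \<alpha> \<beta> x \<le> riesz_product (1 - (\<alpha> + \<beta>) / 2) x"
proof (cases "x$1 = 0 \<or> x$2 = 0 \<or> x$3 = 0")
  case True
  then show ?thesis by (auto simp: V_def riesz_product_def)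
next
  case False
  define t where "t = (\<beta> - \<alpha>) / 2"
  define u where "u = \<bar>x$1\<bar> * \<bar>x$2\<bar> / \<bar>x$3\<bar>"
  have u: "u > 0"
    using False by (simp add: u_def)
  have inv: "\<bar>x$3\<bar> / (\<bar>x$1\<bar> * \<bar>x$2\<bar>) = 1 / u"
    by (simp add: u_def)
  have t: "-1 \<le> t" "t \<le> 1"
    using assms by (auto simp: t_def)
  have "u powr (- t) \<le> u + 1 / u"
  proof (cases "u \<ge> 1")
    case True
    then have "u powr (- t) \<le> u powr 1"
      using t by (intro powr_mono) auto
    then show ?thesis using u by (simp add: add_increasing2)
  next
    case False
    then have "u powr (- t) \<le> u powr (- 1)"
      using t u by (intro powr_mono') auto
    then show ?thesis using u by (simp add: powr_minus_divide)
  qed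
  then have "inverse (u + 1 / u) \<le> inverse (u powr (- t))"
    using u by (intro le_imp_inverse_le) auto
  also have "\<dots> = \<bar>x$1\<bar> powr t * \<bar>x$2\<bar> powr t * \<bar>x$3\<bar> powr (- t)"
    using False by (simp add: powr_minus u_def powr_mult powr_divide divide_simps)
  finally have "V \<alpha> \<beta> x \<le> \<bar>x$1\<bar> powr (\<alpha> - 1) * \<bar>x$2\<bar> powr (\<alpha> - 1) * \<bar>x$3\<bar> powr (\<beta> - 1) *
      (\<bar>x$1\<bar> powr t * \<bar>x$2\<bar> powr t * \<bar>x$3\<bar> powr (- t))"
    unfolding V_def inv u_def[symmetric] by (intro mult_left_mono) auto
  also have "\<dots> = \<bar>x$1\<bar> powr (\<alpha> - 1 + t) * \<bar>x$2\<bar> powr (\<alpha> - 1 + t) * \<bar>x$3\<bar> powr (\<beta> - 1 + - t)"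
    by (simp only: powr_add mult_ac)
  also have "\<alpha> - 1 + t = - (1 - (\<alpha> + \<beta>) / 2)"
    by (simp add: t_def field_simps)
  also have "\<beta> - 1 + - t = - (1 - (\<alpha> + \<beta>) / 2)"
    by (simp add: t_def field_simps)
  finally show ?thesis
    by (simp only: riesz_product_def)
qed

lemma V_nonneg: "0 \<le> V \<alpha> \<beta> x"
  by (simp add: V_def)

lemma measurable_V [measurable]: "V \<alpha> \<beta> \<in> borel_measurable borel"
  unfolding V_def by measurable

subsection \<open>Sufficiency\<close>

lemma riesz_product_minus_commute: "riesz_product l (x - y) = riesz_product l (y - x)"
  by (simp add: riesz_product_def abs_minus_commute)

text \<open>The bilinear form with density \<open>norm (g y) powr p\<close> has
  \<open>norm (g y)\<close> as its first factor, so duality turns the form bound into an L^q bound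
  for the potential of the absolute value of \<open>g\<close>.\<close>

lemma nn_integral_fractional_powr_le:
  fixes g :: "real^3 \<Rightarrow> complex"
  assumes bnd: "bilinear_bound (1 / p) (1 - 1 / q) lborel lborel (\<lambda>y x. ennreal (V \<alpha> \<beta> (x - y))) (ennreal C)"
    and p: "1 < p" and q: "1 < q" and C: "0 \<le> C"
    and [measurable]: "g \<in> borel_measurable borel"
    and int: "integrable lborel (\<lambda>y. norm (g y) powr p)"
  shows "(\<integral>\<^sup>+x. ennpowr (\<integral>\<^sup>+y. ennreal (norm (g y) * V \<alpha> \<beta> (x - y)) \<partial>lborel) q \<partial>lborel)
    \<le> ennreal ((C * (LINT y|lborel. norm (g y) powr p) powr (1 / p)) powr q)"
proof -
  let ?N = "LINT y|lborel. norm (g y) powr p"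
  let ?J = "\<lambda>x. \<integral>\<^sup>+y. ennreal (norm (g y) * V \<alpha> \<beta> (x - y)) \<partial>lborel"
  have N: "(\<integral>\<^sup>+y. ennreal (norm (g y) powr p) \<partial>lborel) = ennreal ?N" "?N \<ge> 0"
    using int by (simp_all add: nn_integral_eq_integral)
  have "(\<integral>\<^sup>+x. ennpowr (?J x) q \<partial>lborel) \<le> ennpowr (ennreal (C * ?N powr (1 / p))) q"
  proof (rule lborel.nn_integral_powr_le_of_dual[OF _ q])
    show "?J \<in> borel_measurable lborel"
      by measurable
    fix G :: "real^3 \<Rightarrow> ennreal" assume G: "G \<in> borel_measurable lborel"
    then have [measurable]: "G \<in> borel_measurable borel" by simp
    have "(\<integral>\<^sup>+x. ?J x * ennpowr (G x) (1 - 1 / q) \<partial>lborel)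
        = (\<integral>\<^sup>+x. \<integral>\<^sup>+y. ennreal (norm (g y) * V \<alpha> \<beta> (x - y)) * ennpowr (G x) (1 - 1 / q) \<partial>lborel \<partial>lborel)"
      by (intro nn_integral_cong nn_integral_multc[symmetric]) measurable
    also have "\<dots> = (\<integral>\<^sup>+y. \<integral>\<^sup>+x. ennreal (norm (g y) * V \<alpha> \<beta> (x - y)) * ennpowr (G x) (1 - 1 / q) \<partial>lborel \<partial>lborel)"
      by (rule lborel_pair.Fubini') measurable
    also have "\<dots> = (\<integral>\<^sup>+y. \<integral>\<^sup>+x. ennpowr (ennreal (norm (g y) powr p)) (1 / p) * ennpowr (G x) (1 - 1 / q)
        * ennreal (V \<alpha> \<beta> (x - y)) \<partial>lborel \<partial>lborel)"
      using p by (intro nn_integral_cong) (simp add: powr_powr ennreal_mult V_nonneg mult_ac)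
    also have "\<dots> \<le> ennreal C * ennpowr (\<integral>\<^sup>+y. ennreal (norm (g y) powr p) \<partial>lborel) (1 / p)
        * ennpowr (\<integral>\<^sup>+x. G x \<partial>lborel) (1 - 1 / q)"
      by (intro bilinear_boundD[OF bnd] G) measurable
    also have "\<dots> = ennreal (C * ?N powr (1 / p)) * ennpowr (\<integral>\<^sup>+x. G x \<partial>lborel) (1 - 1 / q)"
      using C N by (simp add: ennreal_mult)
    finally show "(\<integral>\<^sup>+x. ?J x * ennpowr (G x) (1 - 1 / q) \<partial>lborel)
        \<le> ennreal (C * ?N powr (1 / p)) * ennpowr (\<integral>\<^sup>+x. G x \<partial>lborel) (1 - 1 / q)" .
  qed
  then show ?thesis
    using C by simp
qed

text \<open>Supplies Borel representatives of Lebesgue measurable functions, so that Tonelli can be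
  applied to products of \<open>lborel\<close>.\<close>

lemma completion_ex_borel_measurable_complex:
  fixes f :: "'a \<Rightarrow> complex"
  assumes "f \<in> borel_measurable (completion M)"
  shows "\<exists>g\<in>borel_measurable M. AE x in M. f x = g x"
proof -
  have "(\<lambda>x. Re (f x)) \<in> borel_measurable (completion M)" "(\<lambda>x. Im (f x)) \<in> borel_measurable (completion M)"
    using assms by simp_all
  from this[THEN completion_ex_borel_measurable_real]
  obtain r i where [measurable]: "r \<in> borel_measurable M" "i \<in> borel_measurable M"
    and "AE x in M. Re (f x) = r x" "AE x in M. Im (f x) = i x"
    by blast
  then have "AE x in M. f x = Complex (r x) (i x)"
    by (auto simp: complex_eq_iff)
  moreover have "(\<lambda>x. Complex (r x) (i x)) \<in> borel_measurable M"
    unfolding Complex_eq by measurable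
  ultimately show ?thesis by (rule bexI)
qed

text \<open>The potential \<open>J\<close> of the absolute value controls everything: its L^q bound
  makes it finite almost everywhere, which is absolute convergence, and it dominates the norm of the
  fractional integral, which gives membership in L^q and the estimate.\<close>

lemma frac_int_bound_of_bilinear_bound:
  assumes bnd: "bilinear_bound (1 / p) (1 - 1 / q) lborel lborel (\<lambda>y x. ennreal (V \<alpha> \<beta> (x - y))) (ennreal C)"
    and p: "1 < p" and q: "1 < q" and C: "0 \<le> C"
  shows "frac_int_bound \<alpha> \<beta> p q C"
  unfolding frac_int_bound_def
proof (rule ballI)
  fix f assume "f \<in> Lp_space p"
  then have f [measurable]: "f \<in> borel_measurable lebesgue" and intf: "integrable lebesgue (\<lambda>y. norm (f y) powr p)"
    by (auto simp: Lp_space_def)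
  obtain g where "g \<in> borel_measurable lborel" and fg: "AE y in lborel. f y = g y"
    using completion_ex_borel_measurable_complex[OF f] by blast
  then have [measurable]: "g \<in> borel_measurable borel" by simp
  have fg': "AE y in lebesgue. f y = g y"
    using fg by (rule AE_completion)
  have V' [measurable]: "(\<lambda>y. V \<alpha> \<beta> (x - y)) \<in> borel_measurable lebesgue" for x
    by (rule measurable_completion) measurable
  have mf: "frac_integrand \<alpha> \<beta> f x \<in> borel_measurable lebesgue" for x
    unfolding frac_integrand_def by measurable
  have mg: "frac_integrand \<alpha> \<beta> g x \<in> borel_measurable borel" for x
    unfolding frac_integrand_def by measurable
  have mg': "frac_integrand \<alpha> \<beta> g x \<in> borel_measurable lebesgue" for x
    by (rule measurable_completion) (simp add: mg)
  have fgx: "AE y in lebesgue. frac_integrand \<alpha> \<beta> f x y = frac_integrand \<alpha> \<beta> g x y" for x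
    using fg' by eventually_elim (simp add: frac_integrand_def)
  \<comment> \<open>For each fixed \<open>x\<close> the integrands agree for almost every
    \<open>y\<close>, so the integrals agree at every \<open>x\<close> without exception;
    measurability of the fractional integral of \<open>f\<close> can thus be read off from
    \<open>g\<close>.\<close>
  have If: "frac_int \<alpha> \<beta> f x = (LINT y|lborel. frac_integrand \<alpha> \<beta> g x y)" for x
  proof -
    have "frac_int \<alpha> \<beta> f x = (LINT y|lebesgue. frac_integrand \<alpha> \<beta> g x y)"
      unfolding frac_int_def using mf mg' fgx by (rule integral_cong_AE)
    also have "\<dots> = (LINT y|lborel. frac_integrand \<alpha> \<beta> g x y)"
      using mg by (intro integral_completion) simp
    finally show ?thesis .
  qed
  have mg_powr: "(\<lambda>y. norm (g y) powr p) \<in> borel_measurable lborel"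
    by measurable
  have "integrable lebesgue (\<lambda>y. norm (g y) powr p)"
  proof (rule integrable_cong_AE_imp[OF intf])
    show "(\<lambda>y. norm (g y) powr p) \<in> borel_measurable lebesgue"
      using mg_powr by (rule measurable_completion)
    show "AE y in lebesgue. norm (f y) powr p = norm (g y) powr p"
      using fg' by eventually_elim simp
  qed
  then have intg: "integrable lborel (\<lambda>y. norm (g y) powr p)"
    using integrable_completion[OF mg_powr] by simp
  have normf: "Lp_norm p f = (LINT y|lborel. norm (g y) powr p) powr (1 / p)"
  proof -
    have "(LINT y|lebesgue. norm (f y) powr p) = (LINT y|lebesgue. norm (g y) powr p)"
      using fg' measurable_completion[OF mg_powr] borel_measurable_integrable[OF intf]
      by (intro integral_cong_AE) (auto elim: eventually_mono)
    then show ?thesis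
      by (simp add: Lp_norm_def integral_completion[OF mg_powr])
  qed

  define J where "J x = (\<integral>\<^sup>+y. ennreal (norm (g y) * V \<alpha> \<beta> (x - y)) \<partial>lborel)" for x
  have [measurable]: "J \<in> borel_measurable borel"
    unfolding J_def by measurable
  have J: "(\<integral>\<^sup>+x. ennpowr (J x) q \<partial>lborel) \<le> ennreal ((C * Lp_norm p f) powr q)"
    unfolding J_def normf by (rule nn_integral_fractional_powr_le[OF bnd p q C _ intg]) measurable
  have norm_J: "(\<integral>\<^sup>+y. norm (frac_integrand \<alpha> \<beta> g x y) \<partial>lborel) = J x" for x
    by (simp add: J_def frac_integrand_def norm_mult V_nonneg)
  have "AE x in lborel. ennpowr (J x) q \<noteq> \<infinity>"
  proof (rule nn_integral_PInf_AE)
    show "(\<integral>\<^sup>+x. ennpowr (J x) q \<partial>lborel) \<noteq> \<infinity>"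
      using J by (metis ennreal_less_top infinity_ennreal_def leD)
  qed measurable
  then have "AE x in lborel. integrable lebesgue (frac_integrand \<alpha> \<beta> f x)"
  proof eventually_elim
    case (elim x)
    then have "J x < \<infinity>"
      by (simp add: less_top)
    then have "integrable lborel (frac_integrand \<alpha> \<beta> g x)"
      using mg by (intro integrableI_bounded) (simp_all add: norm_J)
    then have "integrable lebesgue (frac_integrand \<alpha> \<beta> g x)"
      using integrable_completion[of "frac_integrand \<alpha> \<beta> g x" lborel] mg by simp
    then show "integrable lebesgue (frac_integrand \<alpha> \<beta> f x)"
      using mf by (rule integrable_cong_AE_imp) (use fgx[of x] in \<open>auto elim: eventually_mono\<close>)
  qed
  then have ae: "AE x in lebesgue. integrable lebesgue (frac_integrand \<alpha> \<beta> f x)"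
    by (rule AE_completion)

  let ?I = "\<lambda>x. LINT y|lborel. frac_integrand \<alpha> \<beta> g x y"
  have mI [measurable]: "?I \<in> borel_measurable borel"
    unfolding frac_integrand_def by measurable
  \<comment> \<open>Valid at every \<open>x\<close>: where the integral diverges, its default value
    0 satisfies the inequality trivially.\<close>
  have I_le: "ennreal (norm (?I x)) \<le> J x" for x
    using integral_norm_bound_ennreal[of lborel "frac_integrand \<alpha> \<beta> g x"]
    by (cases "integrable lborel (frac_integrand \<alpha> \<beta> g x)") (auto simp: norm_J not_integrable_integral_eq)
  have "(\<integral>\<^sup>+x. ennreal (norm (?I x) powr q) \<partial>lborel) \<le> (\<integral>\<^sup>+x. ennpowr (J x) q \<partial>lborel)"
    using I_le q by (intro nn_integral_mono order.trans[OF _ ennpowr_mono[OF I_le]]) auto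
  then have I: "(\<integral>\<^sup>+x. ennreal (norm (?I x) powr q) \<partial>lborel) \<le> ennreal ((C * Lp_norm p f) powr q)"
    using J by (rule order.trans)
  have intI: "integrable lborel (\<lambda>x. norm (?I x) powr q)"
    using I by (intro integrableI_bounded) (auto intro: le_less_trans[OF _ ennreal_less_top])
  have mIq: "(\<lambda>x. norm (?I x) powr q) \<in> borel_measurable lborel"
    by measurable
  have "ennreal (LINT x|lborel. norm (?I x) powr q) \<le> ennreal ((C * Lp_norm p f) powr q)"
    using I by (subst (asm) nn_integral_eq_integral[OF intI]) auto
  then have "(LINT x|lborel. norm (?I x) powr q) \<le> (C * Lp_norm p f) powr q"
    by (subst (asm) ennreal_le_iff) auto
  then have "(LINT x|lborel. norm (?I x) powr q) powr (1 / q) \<le> ((C * Lp_norm p f) powr q) powr (1 / q)"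
    using q by (intro powr_mono2) auto
  also have "\<dots> = C * Lp_norm p f"
    using q C by (simp add: powr_powr Lp_norm_def)
  finally have "Lp_norm q (frac_int \<alpha> \<beta> f) \<le> C * Lp_norm p f"
    unfolding Lp_norm_def[of q] If integral_completion[OF mIq] .
  moreover have "frac_int \<alpha> \<beta> f \<in> Lp_space q"
    unfolding Lp_space_def If[abs_def]
    using intI integrable_completion[OF mIq] measurable_completion[of ?I lborel borel] by simp
  ultimately show "(AE x in lebesgue. integrable lebesgue (frac_integrand \<alpha> \<beta> f x)) \<and>
        frac_int \<alpha> \<beta> f \<in> Lp_space q \<and> Lp_norm q (frac_int \<alpha> \<beta> f) \<le> C * Lp_norm p f"
    using ae by blast
qed

theorem frac_int_bound_of_homogeneity:
  fixes \<alpha> \<beta> p q :: real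
  assumes "-1 < \<alpha>" "\<alpha> < 1" "-1 < \<beta>" "\<beta> < 1" "\<alpha> + \<beta> > 0" "1 < p" "p < q"
    and hom: "(\<alpha> + \<beta>) / 2 = 1 / p - 1 / q"
  shows "\<exists>C>0. frac_int_bound \<alpha> \<beta> p q C"
proof -
  define l where "l = 1 - (\<alpha> + \<beta>) / 2"
  have "\<exists>C>0. bilinear_bound (1 / p) (1 - 1 / q) lborel lborel (\<lambda>x y. ennreal (riesz_product l (x - y))) (ennreal C)"
  proof (rule hardy_littlewood_sobolev_product)
    \<comment> \<open>The homogeneity condition enters here, as the scale invariance of the
      one-dimensional form.\<close>
    show "1 / p + (1 - 1 / q) + l = 2"
      unfolding l_def hom by simp
    show "l < 1"
      using assms by (simp add: l_def)
  qed (use assms in auto)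
  then obtain C where C: "C > 0"
    and "bilinear_bound (1 / p) (1 - 1 / q) lborel lborel (\<lambda>x y. ennreal (riesz_product l (x - y))) (ennreal C)"
    by blast
  moreover have "V \<alpha> \<beta> (x - y) \<le> riesz_product l (y - x)" for x y
    using V_le_riesz_product[OF assms(1-4), of "x - y"] by (simp only: l_def riesz_product_minus_commute[of _ y x])
  ultimately have "bilinear_bound (1 / p) (1 - 1 / q) lborel lborel (\<lambda>y x. ennreal (V \<alpha> \<beta> (x - y))) (ennreal C)"
    by (elim bilinear_bound_mono) (simp add: ennreal_leI)
  then show ?thesis
    using C assms by (intro exI[of _ C] conjI frac_int_bound_of_bilinear_bound) auto
qed

subsection \<open>Necessity\<close>

text \<open>The kernel is homogeneous of degree \<open>\<alpha> + \<beta> - 2\<close> under \<open>(x\<^sub>1, x\<^sub>2, x\<^sub>3) \<mapsto> (t x\<^sub>1, x\<^sub>2, t x\<^sub>3)\<close>.\<close>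

lemma V_lower_bound:
  fixes z :: "real^3"
  assumes ab: "\<alpha> < 1" "\<beta> < 1" and t: "0 < t"
    and z: "z$1 \<in> {t..3 * t}" "z$2 \<in> {1..3}" "z$3 \<in> {t..3 * t}"
  shows "3 powr (\<alpha> - 1) * 3 powr (\<alpha> - 1) * 3 powr (\<beta> - 1) / 12 * t powr (\<alpha> + \<beta> - 2) \<le> V \<alpha> \<beta> z"
proof -
  have pos: "0 < z$1" "0 < z$2" "0 < z$3"
    using z t by auto
  have "(3 * t) powr (\<alpha> - 1) \<le> z$1 powr (\<alpha> - 1)" "3 powr (\<alpha> - 1) \<le> z$2 powr (\<alpha> - 1)"
      "(3 * t) powr (\<beta> - 1) \<le> z$3 powr (\<beta> - 1)"
    using z t ab by (auto intro!: powr_mono2')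
  \<comment> \<open>The quotient of \<open>z1 z2\<close> by \<open>z3\<close> is at most 9t/t and
    its inverse at most 3t/t, so the bracket is bounded by 9 + 3 = 12 uniformly in
    \<open>t\<close>.\<close>
  moreover have "1 / 12 \<le> inverse (z$1 * z$2 / z$3 + z$3 / (z$1 * z$2))"
  proof -
    have "z$1 * z$2 \<le> (3 * t) * 3"
      using z t by (intro mult_mono) auto
    also have "\<dots> \<le> 9 * z$3"
      using z by simp
    finally have "z$1 * z$2 / z$3 \<le> 9"
      using pos by (simp add: divide_simps)
    moreover have "t * 1 \<le> z$1 * z$2"
      using z t by (intro mult_mono) auto
    then have "z$3 / (z$1 * z$2) \<le> 3"
      using pos z by (simp add: divide_simps)
    ultimately have "z$1 * z$2 / z$3 + z$3 / (z$1 * z$2) \<le> 12"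
      by simp
    then have "inverse 12 \<le> inverse (z$1 * z$2 / z$3 + z$3 / (z$1 * z$2))"
      using pos by (intro le_imp_inverse_le) (auto intro!: add_pos_pos)
    then show ?thesis by simp
  qed
  ultimately have "(3 * t) powr (\<alpha> - 1) * 3 powr (\<alpha> - 1) * (3 * t) powr (\<beta> - 1) * (1 / 12)
     \<le> z$1 powr (\<alpha> - 1) * z$2 powr (\<alpha> - 1) * z$3 powr (\<beta> - 1) * inverse (z$1 * z$2 / z$3 + z$3 / (z$1 * z$2))"
    by (intro mult_mono) auto
  moreover have "t powr (\<alpha> + \<beta> - 2) = t powr (\<alpha> - 1) * t powr (\<beta> - 1)"
    by (simp flip: powr_add)
  ultimately show ?thesis
    using pos t by (simp add: V_def powr_mult mult_ac)
qed

section \<open>Boxes as test sets\<close>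

definition box3 :: "real \<Rightarrow> real \<Rightarrow> real \<Rightarrow> real \<Rightarrow> real \<Rightarrow> real \<Rightarrow> (real^3) set" where
  "box3 a b c d e f = cbox (vector [a, c, e]) (vector [b, d, f])"

lemma mem_box3: "x \<in> box3 a b c d e f \<longleftrightarrow> x$1 \<in> {a..b} \<and> x$2 \<in> {c..d} \<and> x$3 \<in> {e..f}"
  by (auto simp: box3_def mem_box_cart forall_3)

lemma measure_box3:
  assumes "a \<le> b" "c \<le> d" "e \<le> f"
  shows "measure lborel (box3 a b c d e f) = (b - a) * ((d - c) * (f - e))"
proof -
  have "vector [a, c, e] \<in> box3 a b c d e f"
    using assms by (simp add: mem_box3)
  then have "box3 a b c d e f \<noteq> {}"
    by blast
  then have "measure lborel (box3 a b c d e f)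
      = (\<Prod>i\<in>UNIV. (vector [b, d, f] :: real^3) $ i - (vector [a, c, e] :: real^3) $ i)"
    unfolding box3_def by (rule content_cbox_cart)
  then show ?thesis
    unfolding UNIV_3 by simp
qed

lemma box3_lmeasurable [simp]: "box3 a b c d e f \<in> lmeasurable"
  by (simp add: box3_def)

lemma box3_sets [simp, measurable]: "box3 a b c d e f \<in> sets borel"
  by (simp add: box3_def)

lemma indicator_powr: "0 < p \<Longrightarrow> norm (indicator S x :: complex) powr p = indicator S x"
  by (simp add: indicator_def)

text \<open>The two boxes are separated in every coordinate, so all differences \<open>x - y\<close>
  fall in the range of \<open>V_lower_bound\<close>, away from the singular planes. The volume t^2
  of the source box times the degree \<alpha> + \<beta> - 2 of the kernel gives the power \<alpha> +
  \<beta>. Integrability is assumed because a divergent integral would have the default value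
  0.\<close>

lemma frac_int_lower_bound:
  assumes ab: "\<alpha> < 1" "\<beta> < 1" and t: "0 < t"
    and int: "integrable lebesgue (frac_integrand \<alpha> \<beta> (indicator (box3 0 t 0 1 0 t)) x)"
    and x: "x \<in> box3 (2 * t) (3 * t) 2 3 (2 * t) (3 * t)"
  shows "3 powr (\<alpha> - 1) * 3 powr (\<alpha> - 1) * 3 powr (\<beta> - 1) / 12 * t powr (\<alpha> + \<beta>)
    \<le> norm (frac_int \<alpha> \<beta> (indicator (box3 0 t 0 1 0 t)) x)"
proof -
  let ?B = "box3 0 t 0 1 0 t"
  define c where "c = 3 powr (\<alpha> - 1) * 3 powr (\<alpha> - 1) * 3 powr (\<beta> - 1) / 12 * t powr (\<alpha> + \<beta> - 2)"
  have eq: "frac_integrand \<alpha> \<beta> (indicator ?B) x = (\<lambda>y. complex_of_real (indicator ?B y * V \<alpha> \<beta> (x - y)))"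
    by (auto simp: frac_integrand_def indicator_def)
  have intV: "integrable lebesgue (\<lambda>y. indicator ?B y * V \<alpha> \<beta> (x - y))"
    using integrable_Re[OF int] by (simp add: eq)
  have "c * t powr 2 = (LINT y|lebesgue. indicator ?B y * c)"
    using t by (simp add: measure_box3 power2_eq_square)
  also have "\<dots> \<le> (LINT y|lebesgue. indicator ?B y * V \<alpha> \<beta> (x - y))"
  proof (rule integral_mono[OF _ intV])
    show "integrable lebesgue (\<lambda>y. indicator ?B y * c)"
      using box3_lmeasurable[of 0 t 0 1 0 t] by (intro integrable_mult_left integrable_real_indicator) (auto simp: fmeasurable_def)
    show "indicator ?B y * c \<le> indicator ?B y * V \<alpha> \<beta> (x - y)" for y
    proof (cases "y \<in> ?B")
      case True
      then have "c \<le> V \<alpha> \<beta> (x - y)"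
        unfolding c_def using x t by (intro V_lower_bound ab) (auto simp: mem_box3)
      then show ?thesis by (simp add: indicator_def)
    qed simp
  qed
  also have "\<dots> \<le> norm (frac_int \<alpha> \<beta> (indicator ?B) x)"
    by (simp only: frac_int_def eq integral_complex_of_real norm_of_real abs_ge_self)
  finally show ?thesis
    using t by (simp add: c_def powr_diff mult_ac)
qed

lemma powr_bounded_imp_exponent_eq_0:
  fixes e D :: real
  assumes "\<And>t. 0 < t \<Longrightarrow> t powr e \<le> D"
  shows "e = 0"
proof (rule ccontr)
  assume e: "e \<noteq> 0"
  have "0 < D"
    using assms[of 1] by simp
  \<comment> \<open>The choice \<open>t = (D + 1) powr (1 / e)\<close> gives
    \<open>t powr e = D + 1\<close> for either sign of \<open>e\<close>.\<close>
  have "((D + 1) powr (1 / e)) powr e \<le> D"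
    using \<open>0 < D\<close> by (intro assms) simp
  then show False
    using e \<open>0 < D\<close> by (simp add: powr_powr)
qed

text \<open>Source and target box both have volume t^2. The L^q norm is therefore at least a
  constant times t^(\<alpha> + \<beta> + 2/q), while the L^p norm of the indicator is t^(2/p). As
  \<open>t\<close> may tend to 0 as well as to infinity, the exponents must agree.\<close>

theorem homogeneity_of_frac_int_bound:
  assumes ab: "\<alpha> < 1" "\<beta> < 1" and pq: "0 < p" "0 < q" and bnd: "frac_int_bound \<alpha> \<beta> p q C"
  shows "(\<alpha> + \<beta>) / 2 = 1 / p - 1 / q"
proof -
  define c :: real where "c = 3 powr (\<alpha> - 1) * 3 powr (\<alpha> - 1) * 3 powr (\<beta> - 1) / 12"
  have c: "c > 0"
    by (simp add: c_def)
  have "t powr (\<alpha> + \<beta> + 2 / q - 2 / p) \<le> C / c" if t: "0 < t" for t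
  proof -
    let ?f = "indicator (box3 0 t 0 1 0 t) :: real^3 \<Rightarrow> complex"
    let ?B = "box3 (2 * t) (3 * t) 2 3 (2 * t) (3 * t)"
    have "integrable lebesgue (\<lambda>x. indicator (box3 0 t 0 1 0 t) x :: real)"
      using box3_lmeasurable[of 0 t 0 1 0 t] by (intro integrable_real_indicator) (auto simp: fmeasurable_def)
    moreover have "?f \<in> borel_measurable lebesgue"
      by (intro measurable_completion borel_measurable_indicator) simp
    ultimately have f: "?f \<in> Lp_space p"
      using pq by (simp add: Lp_space_def indicator_powr)
    have normf: "Lp_norm p ?f = t powr (2 / p)"
    proof -
      have "Lp_norm p ?f = (t powr 2) powr (1 / p)"
        using pq t by (simp add: Lp_norm_def indicator_powr measure_box3 power2_eq_square)
      then show ?thesis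
        using powr_powr[of t 2 "1 / p"] by simp
    qed
    let ?I = "frac_int \<alpha> \<beta> ?f"
    have ae: "AE x in lebesgue. integrable lebesgue (frac_integrand \<alpha> \<beta> ?f x)"
      and I: "integrable lebesgue (\<lambda>x. norm (?I x) powr q)" and le: "Lp_norm q ?I \<le> C * Lp_norm p ?f"
      using bnd f unfolding frac_int_bound_def Lp_space_def by blast+
    have "(c * t powr (\<alpha> + \<beta>)) powr q * t powr 2 = (LINT x|lebesgue. indicator ?B x * (c * t powr (\<alpha> + \<beta>)) powr q)"
      using t by (simp add: measure_box3 power2_eq_square)
    also have "\<dots> \<le> (LINT x|lebesgue. norm (?I x) powr q)"
    proof (rule integral_mono_AE[OF _ I])
      show "integrable lebesgue (\<lambda>x. indicator ?B x * (c * t powr (\<alpha> + \<beta>)) powr q)"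
        using box3_lmeasurable[of "2 * t" "3 * t" 2 3 "2 * t" "3 * t"]
        by (intro integrable_mult_left integrable_real_indicator) (auto simp: fmeasurable_def)
      show "AE x in lebesgue. indicator ?B x * (c * t powr (\<alpha> + \<beta>)) powr q \<le> norm (?I x) powr q"
        using ae
      proof eventually_elim
        case (elim x)
        show ?case
        proof (cases "x \<in> ?B")
          case True
          have "c * t powr (\<alpha> + \<beta>) \<le> norm (?I x)"
            unfolding c_def using ab t elim True by (rule frac_int_lower_bound)
          then show ?thesis
            using True c pq by (simp add: powr_mono2)
        qed simp
      qed
    qed
    finally have "((c * t powr (\<alpha> + \<beta>)) powr q * t powr 2) powr (1 / q) \<le> Lp_norm q ?I"
      unfolding Lp_norm_def using pq by (intro powr_mono2) auto
    also have "((c * t powr (\<alpha> + \<beta>)) powr q * t powr 2) powr (1 / q) = c * t powr (\<alpha> + \<beta>) * t powr (2 / q)"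
      using c pq t powr_powr[of t 2 "1 / q"] by (simp add: powr_mult powr_powr)
    also note le
    finally have "c * (t powr (\<alpha> + \<beta>) * t powr (2 / q)) \<le> C * t powr (2 / p)"
      by (simp add: normf mult_ac)
    then show ?thesis
      using c t by (simp add: powr_add powr_diff field_simps)
  qed
  then have "\<alpha> + \<beta> + 2 / q - 2 / p = 0"
    by (rule powr_bounded_imp_exponent_eq_0)
  then show ?thesis by simp
qed

theorem mainTheorem1:
  fixes \<alpha> \<beta> p q :: real
  assumes "-1 < \<alpha>" "\<alpha> < 1" "-1 < \<beta>" "\<beta> < 1" "\<alpha> + \<beta> > 0"
    and "1 < p" "p < q"
  shows "(\<exists>C>0. frac_int_bound \<alpha> \<beta> p q C) \<longleftrightarrow> (\<alpha> + \<beta>) / 2 = 1 / p - 1 / q"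
proof
  assume "\<exists>C>0. frac_int_bound \<alpha> \<beta> p q C"
  then show "(\<alpha> + \<beta>) / 2 = 1 / p - 1 / q"
    using assms homogeneity_of_frac_int_bound[of \<alpha> \<beta> p q] by auto
next
  assume "(\<alpha> + \<beta>) / 2 = 1 / p - 1 / q"
  with assms show "\<exists>C>0. frac_int_bound \<alpha> \<beta> p q C"
    by (rule frac_int_bound_of_homogeneity)
qed

end
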